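(* For every complex number $q$ with $0<|q|<1$, \begin{align*} \sum_{n=1}^\infty \frac{q^n(q;q^2)_n}{(-q;q^2)_n(1+q^{2n})} &= \sum_{n=1}^\infty \sum_{|m|\leq n}(-1)^mq^{n^2+m^2}-\sum_{n=1}^\infty (-1)^nq^{2n^2}\\ &=\frac{1}{2}\left\{ g_{1,0,1}(q^2,q^2;q^4)+q\,g_{1,0,1}(q^4,q^4;q^4) + j(q^2;q^4)\right\} - \sum_{n=1}^\infty (-1)^nq^{2n^2}\\ &=\frac{1}{2}\left\{ g_{1,0,1}(q^2,q^2;q^4)+q\,g_{1,0,1}(q^4,q^4;q^4) + 1\right\}. \end{align*}
   Context: Notation: $(x;q)_n:=\prod_{i=0}^{n-1}(1-q^ix)$, $(x;q)_\infty:=\prod_{i=0}^{\infty}(1-q^ix)$. Theta function: $j(x;q):=(x;q)_\infty(q/x;q)_\infty(q;q)_\infty=\sum_{n\in\mathbb{Z}}(-1)^nq^{\binom n2}x^n$, for $x\neq 0$. Type II double-sum: $$g_{a,b,c}(x,y;q):=\Big(\sum_{r,s\ge 0}+\sum_{r,s<0}\Big)(-1)^{r+s}x^ry^sq^{a\binom r2+brs+c\binom s2},$$ where $r,s$ run over integers, the first sum is over pairs with both $r,s\ge0$ and the second over pairs with both $r,s<0$, and $\binom{r}{2}=r(r-1)/2$ for all integers $r$.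
   Formalization: As printed, the third and fourth expressions exceed the first two by exactly 1 (as q tends to 0 they tend to 1, the others to 0); the formal theorem subtracts 1 from the third expression and replaces "+1" by "-1" in the braces of the fourth. *)

theory Defs
  imports "HOL-Analysis.Analysis"
begin

definition qpoch :: "complex \<Rightarrow> complex \<Rightarrow> nat \<Rightarrow> complex" where
  "qpoch x q n = (\<Prod>i<n. 1 - q ^ i * x)"

definition qpoch_inf :: "complex \<Rightarrow> complex \<Rightarrow> complex" where
  "qpoch_inf x q = (\<Prod>i. 1 - q ^ i * x)"

definition theta_j :: "complex \<Rightarrow> complex \<Rightarrow> complex" where
  "theta_j x q = qpoch_inf x q * qpoch_inf (q / x) q * qpoch_inf q q"

(* The binomial coefficient "r choose 2" at an arbitrary integer r; r * (r - 1) is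
   always even, so the integer division is exact. *)
definition binom2 :: "int \<Rightarrow> int" where
  "binom2 r = r * (r - 1) div 2"

definition g_term ::
  "int \<Rightarrow> int \<Rightarrow> int \<Rightarrow> complex \<Rightarrow> complex \<Rightarrow> complex \<Rightarrow> int \<Rightarrow> int \<Rightarrow> complex" where
  "g_term a b c x y q r s =
     (-1) powi (r + s) * x powi r * y powi s * q powi (a * binom2 r + b * r * s + c * binom2 s)"

definition g_sum ::
  "int \<Rightarrow> int \<Rightarrow> int \<Rightarrow> complex \<Rightarrow> complex \<Rightarrow> complex \<Rightarrow> complex" where
  "g_sum a b c x y q =
     (\<Sum>\<^sub>\<infinity>(r, s) \<in> {0..} \<times> {0..}. g_term a b c x y q r s) +
     (\<Sum>\<^sub>\<infinity>(r, s) \<in> {..<0} \<times> {..<0}. g_term a b c x y q r s)"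

(* Erratum to the identity formalized with these definitions: in print, the two expressions
   in g_sum lack the "- 1" in the middle one and have "+ 1" instead of "- 1" in the last one.
   As printed they exceed the q-series by exactly 1: as q tends to 0, the q-series tends to 0,
   while g_sum 1 0 1 (q^2) (q^2) (q^4) and theta_j (q^2) (q^4) tend to 1. The missing 1 is the
   n = 0 term of the sum over |m| <= n. *)

end

theory Submission
  imports Defs "HOL-Real_Asymp.Real_Asymp"
begin

text \<open>
  Write \<open>(x)_n\<close> for the shifted factorials in base \<open>q^2\<close> and
  \<open>T_n = (\<Sum>|m|\<le>n. (-1)^m q^(m^2)) - (-1)^n q^(n^2)\<close>, so that the first identity reads
  \<open>\<Sum>n\<ge>1. q^n (q)_n / ((-q)_n (1 + q^(2n))) = \<Sum>r\<ge>1. q^(r^2) T_r\<close>. It is an instance of Bailey's lemma,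
  with base \<open>q^2\<close>, \<open>a = 1\<close>, \<open>\<rho>\<^sub>1 = q\<close> and \<open>\<rho>\<^sub>2 \<rightarrow> 1\<close>, for the Bailey pair
  \<open>\<alpha>_r = q^(r^2-r) (1 - q^(2r)) T_r\<close>, \<open>\<beta>_n = (1 - q^(2n)) / ((1 + q^(2n)) (-q)_n (q^2)_n)\<close>.
  Summation by parts reduces the Bailey pair to a terminating sum with a WZ certificate. The q-Gauss
  sum needed on the other side also has a WZ certificate; summed over a finite range of \<open>n\<close> it gives
  the partial sums of the q-series with an explicit error term of size \<open>O(N^3 |q|^N)\<close>.

  In the indefinite double sum, the substitutions \<open>n = r + s, m = r - s\<close> and
  \<open>n = r + s + 1, m = r - s\<close> separate the two parities of \<open>n + m\<close> and factor both parts into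
  squares, as do the sums \<open>g\<^sub>1\<^sub>,\<^sub>0\<^sub>,\<^sub>1\<close>. The theta function is evaluated as the limit of a
  finite triple product identity.
\<close>

section \<open>Shifted factorials\<close>

text \<open>Extending \<open>1 / (Q; Q)\<^sub>k\<close> by \<open>0\<close> to \<open>k < 0\<close> makes \<open>invpoch_diff_1\<close> hold for all integers \<open>k\<close>, so that the
  telescoping identities below need no boundary cases.\<close>

definition invpoch :: "complex \<Rightarrow> int \<Rightarrow> complex" where
  "invpoch Q k = (if k < 0 then 0 else inverse (qpoch Q Q (nat k)))"

lemma qpoch_0 [simp]: "qpoch x Q 0 = 1"
  by (simp add: qpoch_def)

lemma qpoch_Suc: "qpoch x Q (Suc n) = qpoch x Q n * (1 - Q ^ n * x)"
  by (simp add: qpoch_def)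

lemma invpoch_neg [simp]: "k < 0 \<Longrightarrow> invpoch Q k = 0"
  by (simp add: invpoch_def)

lemma invpoch_0 [simp]: "invpoch Q 0 = 1"
  by (simp add: invpoch_def)

lemma power_neq_one:
  fixes q :: complex
  assumes "norm q < 1" "0 < n"
  shows "q ^ n \<noteq> 1" "q ^ n \<noteq> -1"
proof -
  have "norm (q ^ n) < 1"
    using assms by (simp add: norm_power power_less_one_iff)
  thus "q ^ n \<noteq> 1" "q ^ n \<noteq> -1" by auto
qed

lemma invpoch_diff_1:
  assumes "norm Q < 1"
  shows "invpoch Q (k - 1) = (1 - Q powi k) * invpoch Q k"
proof (cases "k \<le> 0")
  case True
  thus ?thesis by (cases "k = 0") auto
next
  case False
  define m where "m = nat (k - 1)"
  have k: "k = int (Suc m)" using False by (simp add: m_def)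
  have "Q ^ Suc m \<noteq> 1" by (rule power_neq_one) (use assms in auto)
  hence "1 - Q ^ m * Q \<noteq> 0" by (simp add: mult.commute)
  moreover have "Q powi k = Q ^ m * Q"
    unfolding k by (simp add: power_int_def nat_add_distrib mult.commute)
  ultimately show ?thesis
    by (simp add: k invpoch_def qpoch_Suc nat_add_distrib mult.commute)
qed

text \<open>Both facts rest on absolute convergence: the deviations of the factors from 1 form a
  geometric series, and a convergent product vanishes only if one of its factors does.\<close>

lemma
  assumes "norm Q < 1"
  shows qpoch_LIMSEQ: "qpoch x Q \<longlonglongrightarrow> qpoch_inf x Q"
    and qpoch_inf_nonzero: "(\<And>i. Q ^ i * x \<noteq> 1) \<Longrightarrow> qpoch_inf x Q \<noteq> 0"
proof -
  have "summable (\<lambda>i. norm (1 - Q ^ i * x - 1))"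
    using assms by (simp add: norm_mult norm_power summable_geometric summable_mult2)
  hence conv: "convergent_prod (\<lambda>i. 1 - Q ^ i * x)"
    by (intro abs_convergent_prod_imp_convergent_prod summable_imp_abs_convergent_prod)
  have "(\<lambda>n. qpoch x Q (Suc n)) \<longlonglongrightarrow> qpoch_inf x Q"
    using convergent_prod_LIMSEQ[OF conv] unfolding qpoch_def lessThan_Suc_atMost qpoch_inf_def .
  thus "qpoch x Q \<longlonglongrightarrow> qpoch_inf x Q"
    by (rule LIMSEQ_imp_Suc)
  show "qpoch_inf x Q \<noteq> 0" if "\<And>i. Q ^ i * x \<noteq> 1"
    unfolding qpoch_inf_def using prodinf_nonzero[OF conv] that by auto
qed

lemma qpoch_bounded:
  assumes "norm Q < 1"
  obtains C where "C > 0" "\<And>n. norm (qpoch x Q n) \<le> C"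
  using convergent_imp_Bseq[OF convergentI[OF qpoch_LIMSEQ[OF assms]]] unfolding Bseq_def by metis

lemma inverse_qpoch_bounded:
  assumes "norm Q < 1" "\<And>i. Q ^ i * x \<noteq> 1"
  obtains C where "C > 0" "\<And>n. norm (inverse (qpoch x Q n)) \<le> C"
  using convergent_imp_Bseq[OF convergentI[OF tendsto_inverse
    [OF qpoch_LIMSEQ[OF assms(1)] qpoch_inf_nonzero[OF assms]]]]
  unfolding Bseq_def by metis

lemma invpoch_bounded:
  assumes "norm Q < 1"
  obtains C where "C > 0" "\<And>k. norm (invpoch Q k) \<le> C"
proof -
  have "Q ^ i * Q \<noteq> 1" for i
    using power_neq_one(1)[OF assms, of "Suc i"] by (simp add: mult.commute)
  then obtain C where "C > 0" "\<And>n. norm (inverse (qpoch Q Q n)) \<le> C"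
    using inverse_qpoch_bounded[OF assms] by blast
  thus ?thesis by (intro that[of C]) (auto simp: invpoch_def)
qed

lemma invpoch_LIMSEQ:
  assumes "norm Q < 1" "filterlim k at_top sequentially"
  shows "(\<lambda>n. invpoch Q (k n)) \<longlonglongrightarrow> inverse (qpoch_inf Q Q)"
proof -
  have "Q ^ i * Q \<noteq> 1" for i
    using power_neq_one(1)[OF assms(1), of "Suc i"] by (simp add: mult.commute)
  hence "(\<lambda>n. inverse (qpoch Q Q n)) \<longlonglongrightarrow> inverse (qpoch_inf Q Q)"
    using assms(1) by (intro tendsto_inverse qpoch_LIMSEQ qpoch_inf_nonzero)
  moreover have "filterlim (\<lambda>n. nat (k n)) at_top sequentially"
    by (rule filterlim_compose[OF filterlim_nat_sequentially assms(2)])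
  ultimately have "(\<lambda>n. inverse (qpoch Q Q (nat (k n)))) \<longlonglongrightarrow> inverse (qpoch_inf Q Q)"
    by (rule filterlim_compose)
  moreover have "eventually (\<lambda>n. k n \<ge> 0) sequentially"
    using assms(2) by (simp add: filterlim_at_top)
  hence "eventually (\<lambda>n. inverse (qpoch Q Q (nat (k n))) = invpoch Q (k n)) sequentially"
    by eventually_elim (simp add: invpoch_def)
  ultimately show ?thesis
    by (rule Lim_transform_eventually)
qed

section \<open>Summation lemmas\<close>

lemma abel_summation:
  fixes g T :: "nat \<Rightarrow> 'a :: comm_ring"
  shows "(\<Sum>r\<le>m. (g r - g (Suc r)) * T r) =
     g 0 * T 0 + (\<Sum>r<m. g (Suc r) * (T (Suc r) - T r)) - g (Suc m) * T m"
  by (induction m) (simp_all add: algebra_simps)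

text \<open>Links unordered sums to ordered partial sums, in terms of which the first identity is
  proved.\<close>

lemma infsum_atLeast_1_LIMSEQ:
  fixes f :: "nat \<Rightarrow> complex"
  assumes "f summable_on {1..}"
  shows "(\<lambda>N. \<Sum>n=1..N. f n) \<longlonglongrightarrow> infsum f {1..}"
proof -
  have "(f has_sum infsum f {1..}) {1..}" using assms by simp
  hence "((\<lambda>n. if n = 0 then 0 else f n) has_sum infsum f {1..}) UNIV"
    by (rule iffD1[OF has_sum_cong_neutral, rotated -1]) auto
  hence "(\<lambda>n. if n = 0 then 0 else f n) sums infsum f {1..}"
    by (rule has_sum_imp_sums)
  hence "(\<lambda>N. \<Sum>n\<le>N. if n = 0 then 0 else f n) \<longlonglongrightarrow> infsum f {1..}"
    by (simp add: sums_def_le)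
  moreover have "(\<Sum>n\<le>N. if n = 0 then 0 else f n) = (\<Sum>n=1..N. f n)" for N
    by (intro sum.mono_neutral_cong_right) auto
  ultimately show ?thesis by simp
qed

lemma has_sum_product:
  fixes f :: "'a \<Rightarrow> complex" and g :: "'b \<Rightarrow> complex"
  assumes "(\<lambda>x. norm (f x)) summable_on A" "(\<lambda>y. norm (g y)) summable_on B"
  shows "((\<lambda>(x, y). f x * g y) has_sum (infsum f A * infsum g B)) (A \<times> B)"
proof (rule has_sum_SigmaI)
  show "((\<lambda>y. case (x, y) of (x, y) \<Rightarrow> f x * g y) has_sum (f x * infsum g B)) B" for x
    using has_sum_cmult_right[OF has_sum_infsum[OF abs_summable_summable[OF assms(2)]]] by simp
  show "((\<lambda>x. f x * infsum g B) has_sum (infsum f A * infsum g B)) A"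
    by (rule has_sum_cmult_left[OF has_sum_infsum[OF abs_summable_summable[OF assms(1)]]])
  have "(\<lambda>(x, y). norm (f x) * norm (g y)) summable_on A \<times> B"
  proof (rule summable_on_SigmaI)
    show "((\<lambda>y. case (x, y) of (x, y) \<Rightarrow> norm (f x) * norm (g y)) has_sum
            (norm (f x) * infsum (\<lambda>y. norm (g y)) B)) B" for x
      using has_sum_cmult_right[OF has_sum_infsum[OF assms(2)]] by simp
  qed (auto intro!: summable_on_cmult_left assms)
  hence "(\<lambda>z. norm (case z of (x, y) \<Rightarrow> f x * g y)) summable_on A \<times> B"
    by (simp add: case_prod_unfold norm_mult)
  thus "(\<lambda>(x, y). f x * g y) summable_on A \<times> B"
    by (rule abs_summable_summable)
qed

text \<open>With b = 0 the summand separates in r and s, and both factors are the same function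
  \<open>f\<close>; so each quadrant contributes a square.\<close>

lemma g_sum_diagonal:
  assumes "f = (\<lambda>r. (-1) powi r * x powi r * q powi binom2 r)" "q \<noteq> 0"
    and "(\<lambda>r. norm (f r)) summable_on {0..}" "(\<lambda>r. norm (f r)) summable_on {..<0}"
  shows "g_sum 1 0 1 x x q = (infsum f {0..})^2 + (infsum f {..<0})^2"
proof -
  have "(\<lambda>(r, s). g_term 1 0 1 x x q r s) = (\<lambda>(r, s). f r * f s)"
    using assms(2) by (auto simp: g_term_def assms(1) power_int_add mult_ac)
  thus ?thesis
    unfolding g_sum_def
    using infsumI[OF has_sum_product[OF assms(3,3)]] infsumI[OF has_sum_product[OF assms(4,4)]]
    by (simp add: power2_eq_square)
qed

lemma double_binom2: "2 * binom2 r = r * (r - 1)"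
  unfolding binom2_def by (simp add: even_mult_iff)

lemma bij_betw_int_nonneg: "bij_betw int UNIV {0..}"
  by (rule bij_betwI[where g = nat]) auto

lemma bij_betw_int_neg: "bij_betw (\<lambda>k. - int k) {1..} {..<0}"
  by (rule bij_betwI[where g = "\<lambda>k. nat (- k)"]) auto

lemma bij_betw_int_neg_shift: "bij_betw (\<lambda>k. - 1 - int k) UNIV {..<0}"
  by (rule bij_betwI[where g = "\<lambda>k. nat (- k - 1)"]) auto

section \<open>The Bailey pair and the q-Gauss sum\<close>

text \<open>The term \<open>r = 0\<close> of the q-Gauss sum is \<open>0\<close> here because its \<open>n = 0\<close> summand, equal to \<open>1\<close> in the
  limit \<open>\<rho>\<^sub>2 \<rightarrow> 1\<close>, is left out; this explains the case distinction in \<open>sum_gauss_term\<close>.\<close>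

definition gauss_weight :: "complex \<Rightarrow> nat \<Rightarrow> complex" where
  "gauss_weight q n = q ^ n * qpoch q (q^2) n * qpoch (q^2) (q^2) (n - 1)"

text \<open>Here \<open>gauss_weight\<close> is the Bailey weight (rho1)_n (rho2)_n (q^2/(rho1
  rho2))^n with the factor 1 - rho2 divided out before rho2 tends to 1. The factor (1 - q^(2r)) /
  q^r times q^(r^2) T_r is alpha_r.\<close>

definition gauss_term :: "complex \<Rightarrow> nat \<Rightarrow> nat \<Rightarrow> complex" where
  "gauss_term q n r = gauss_weight q n * (1 - q ^ (2 * r)) / q ^ r *
     (invpoch (q^2) (int n - int r) * invpoch (q^2) (int n + int r))"

text \<open>The WZ mate of \<open>gauss_term\<close>: its differences in n are the differences of
  \<open>gauss_term\<close> in r.\<close>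

definition gauss_cert :: "complex \<Rightarrow> nat \<Rightarrow> nat \<Rightarrow> complex" where
  "gauss_cert q n r = - gauss_weight q n * (1 + q ^ (2 * r + 1)) / q ^ (r + 1) *
     (invpoch (q^2) (int n - int r - 1) * invpoch (q^2) (int n + int r))"

text \<open>What summation by parts leaves of the Bailey pair; summed over s it gives 1 / ((-q)_n
  (q^2)_(n-1)) for n > 0.\<close>

definition bailey_term :: "complex \<Rightarrow> nat \<Rightarrow> nat \<Rightarrow> complex" where
  "bailey_term q n s = (-1) ^ s * q ^ (s * (2 * s + 1)) * (1 - q ^ (2 * s + 1)) *
     (invpoch (q^2) (int n - 1 - int s) * invpoch (q^2) (int n + int s))"

text \<open>Vanishes at s = 0 because of 1 - 1/q^(2s) and at s > n because of
  \<open>invpoch\<close>, so the telescoped sum has no boundary terms.\<close>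

definition bailey_cert :: "complex \<Rightarrow> nat \<Rightarrow> nat \<Rightarrow> complex" where
  "bailey_cert q n s = (-1) ^ s * q ^ (s * (2 * s + 1)) * q ^ (2 * n) * (1 - 1 / q ^ (2 * s)) *
     (invpoch (q^2) (int n - int s) * invpoch (q^2) (int n + int s))"

text \<open>This is T_n, for n > 0 the mean of the theta sums over |m| < n and |m| \<le> n. In this
  form T_0 = 0 and T_(s+1) - T_s is a single explicit term, as summation by parts requires.\<close>

definition theta_mean :: "complex \<Rightarrow> nat \<Rightarrow> complex" where
  "theta_mean q n = (\<Sum>k<n. (-1) ^ k * q ^ (k^2) * (1 - q ^ (2 * k + 1)))"

definition summand :: "complex \<Rightarrow> nat \<Rightarrow> complex" where
  "summand q n = q ^ n * qpoch q (q^2) n / (qpoch (- q) (q^2) n * (1 + q ^ (2 * n)))"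

context
  fixes q :: complex
  assumes q0: "q \<noteq> 0" and q1: "norm q < 1"
begin

lemma norm_q2: "norm (q^2) < 1"
  using q1 by (simp add: norm_power power_less_one_iff)

lemma invpoch_down: "invpoch (q^2) (k - 1) = (1 - q powi (2 * k)) * invpoch (q^2) k"
  using invpoch_diff_1[OF norm_q2] by (simp add: power_int_mult)

lemma invpoch_downI:
  assumes "a = q powi (2 * k)" "j = k - 1"
  shows "invpoch (q^2) j = (1 - a) * invpoch (q^2) k"
  using assms invpoch_down by simp

section \<open>The q-Gauss sum over a finite range of n\<close>

lemma gauss_term_diff:
  assumes "0 < n"
  shows "gauss_term q n (Suc r) - gauss_term q n r = gauss_cert q (Suc n) r - gauss_cert q n r"
proof -
  \<comment> \<open>\<open>J\<close> and \<open>K\<close> have the largest indices that occur. By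
    \<open>invpoch_down\<close> every other reciprocal factorial is a multiple of one of them, even
    at negative indices, and a rational identity in \<open>X\<close>, \<open>y\<close> and
    \<open>q\<close> remains.\<close>
  define X y J K where "X = q ^ n" and "y = q ^ r"
    and "J = invpoch (q^2) (int n - int r)" and "K = invpoch (q^2) (int n + int r + 1)"
  have y: "y \<noteq> 0" using q0 by (simp add: y_def)
  obtain m where n: "n = Suc m" using assms by (cases n) auto
  \<comment> \<open>The index n - 1 in \<open>gauss_weight\<close> is truncated at 0, so this
    recurrence fails for n = 0.\<close>
  have A: "gauss_weight q (Suc n) = gauss_weight q n * q * (1 - q * X^2) * (1 - X^2)"
    by (simp add: gauss_weight_def n X_def qpoch_Suc algebra_simps flip: power_mult power_add)
  have J: "invpoch (q^2) (int n - int r - 1) = (1 - X^2 / y^2) * J"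
    unfolding J_def X_def y_def
    by (rule invpoch_downI)
       (use q0 in \<open>auto simp: power_int_diff power_int_mult power2_eq_square power_mult_distrib\<close>)
  have K: "invpoch (q^2) (int n + int r) = (1 - X^2 * y^2 * q^2) * K"
    unfolding K_def X_def y_def
    by (rule invpoch_downI)
       (use q0 in \<open>auto simp: power_int_add power_int_mult distrib_left mult_ac\<close>)
  have p: "q ^ (2 * r) = y^2" "q ^ (2 * Suc r) = q^2 * y^2" "q ^ (2 * r + 1) = q * y^2"
     "q ^ (r + 1) = q * y" "q ^ Suc r = q * y"
    by (simp_all add: y_def power_add mult_2 power2_eq_square)
  have e: "int n - int (Suc r) = int n - int r - 1" "int n + int (Suc r) = int n + int r + 1"
    "int (Suc n) - int r - 1 = int n - int r" "int (Suc n) + int r = int n + int r + 1"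
    by auto
  show ?thesis
    unfolding gauss_term_def gauss_cert_def e J K A p J_def[symmetric] K_def[symmetric] y_def[symmetric]
    using y q0 by (simp add: field_simps power2_eq_square)
qed

text \<open>Summing the WZ equation over n telescopes to the certificate at N + 1 and at 1. The
  latter is nonzero only at r = 0, and this is the origin of the value 1 for r > 0.\<close>

lemma sum_gauss_term:
  "(\<Sum>n=1..N. gauss_term q n r) = (if r = 0 then 0 else 1) + (\<Sum>j<r. gauss_cert q (Suc N) j)"
proof (induction r)
  case 0
  thus ?case by (simp add: gauss_term_def)
next
  case (Suc r)
  have "(\<Sum>n=1..N. gauss_term q n (Suc r)) - (\<Sum>n=1..N. gauss_term q n r) = (\<Sum>n=1..N. gauss_cert q (Suc n) r - gauss_cert q n r)"
    unfolding sum_subtractf[symmetric] by (intro sum.cong refl gauss_term_diff) auto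
  also have "\<dots> = gauss_cert q (Suc N) r - gauss_cert q 1 r"
    by (cases "N = 0") (auto intro!: sum_Suc_diff)
  also have "gauss_cert q 1 r = (if r = 0 then -1 else 0)"
    using q0 power_neq_one[OF q1, of 2]
    by (auto simp: gauss_cert_def gauss_weight_def invpoch_def qpoch_def field_simps power2_eq_square)
  finally show ?case
    using Suc.IH by (auto simp: algebra_simps split: if_splits)
qed

section \<open>The terminating sum behind the Bailey pair\<close>

lemma bailey_term_diff:
  "(1 + q ^ (2 * n + 1)) * (1 - q ^ (2 * n)) * bailey_term q (Suc n) s - bailey_term q n s =
     bailey_cert q n (Suc s) - bailey_cert q n s"
proof -
  define X y J K E where "X = q ^ n" and "y = q ^ s"
    and "J = invpoch (q^2) (int n - int s)" and "K = invpoch (q^2) (int n + int s + 1)"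
    and "E = (-1) ^ s * q ^ (s * (2 * s + 1))"
  have y: "y \<noteq> 0" using q0 by (simp add: y_def)
  have J: "invpoch (q^2) (int n - int s - 1) = (1 - X^2 / y^2) * J"
    unfolding J_def X_def y_def
    by (rule invpoch_downI)
       (use q0 in \<open>auto simp: power_int_diff power_int_mult power2_eq_square power_mult_distrib\<close>)
  have K: "invpoch (q^2) (int n + int s) = (1 - X^2 * y^2 * q^2) * K"
    unfolding K_def X_def y_def
    by (rule invpoch_downI)
       (use q0 in \<open>auto simp: power_int_add power_int_mult distrib_left mult_ac\<close>)
  have "Suc s * (2 * Suc s + 1) = s * (2 * s + 1) + 4 * s + 3"
    by (simp add: algebra_simps)
  hence "q ^ (Suc s * (2 * Suc s + 1)) = q ^ (s * (2 * s + 1)) * y ^ 4 * q ^ 3"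
    by (simp only: y_def power_add power_mult [symmetric] mult.commute)
  hence E: "(-1) ^ Suc s * q ^ (Suc s * (2 * Suc s + 1)) = - E * y ^ 4 * q ^ 3"
    by (simp add: E_def)
  have p: "q ^ (2 * s) = y^2" "q ^ (2 * Suc s) = q^2 * y^2" "q ^ (2 * s + 1) = q * y^2"
     "q ^ (2 * n) = X^2" "q ^ (2 * n + 1) = q * X^2"
    by (simp_all add: y_def X_def power_add mult_2 power2_eq_square)
  have e: "int (Suc n) - 1 - int s = int n - int s" "int (Suc n) + int s = int n + int s + 1"
     "int n - 1 - int s = int n - int s - 1"
    "int n - int (Suc s) = int n - int s - 1" "int n + int (Suc s) = int n + int s + 1"
    by auto
  show ?thesis
    unfolding bailey_term_def bailey_cert_def E e J K E_def[symmetric] p J_def[symmetric] K_def[symmetric]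
    using y q0 by (simp add: field_simps) algebra
qed

lemma sum_bailey_term:
  "(\<Sum>s<Suc n. bailey_term q (Suc n) s) * (qpoch (- q) (q^2) (Suc n) * qpoch (q^2) (q^2) n) = 1"
proof (induction n)
  case 0
  have "1 + q \<noteq> 0" "1 - q^2 \<noteq> 0" using power_neq_one[OF q1, of 1] power_neq_one[OF q1, of 2]
    by (auto simp: eq_neg_iff_add_eq_0 add.commute)
  thus ?case
    by (simp add: bailey_term_def invpoch_def qpoch_def field_simps power2_eq_square)
next
  case (Suc n)
  let ?c = "(1 + q ^ (2 * Suc n + 1)) * (1 - q ^ (2 * Suc n))"
  have "?c * (\<Sum>s<Suc (Suc n). bailey_term q (Suc (Suc n)) s) - (\<Sum>s<Suc (Suc n). bailey_term q (Suc n) s)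
      = (\<Sum>s<Suc (Suc n). bailey_cert q (Suc n) (Suc s) - bailey_cert q (Suc n) s)"
    unfolding sum_distrib_left sum_subtractf[symmetric] by (intro sum.cong refl bailey_term_diff)
  also have "\<dots> = bailey_cert q (Suc n) (Suc (Suc n)) - bailey_cert q (Suc n) 0"
    by (rule sum_lessThan_telescope)
  also have "\<dots> = 0" by (simp add: bailey_cert_def)
  \<comment> \<open>The additional index s = n + 1 brings in a reciprocal factorial of index -1,
    which is 0.\<close>
  also have "(\<Sum>s<Suc (Suc n). bailey_term q (Suc n) s) = (\<Sum>s<Suc n. bailey_term q (Suc n) s)"
    by (simp add: bailey_term_def)
  finally have eq: "?c * (\<Sum>s<Suc (Suc n). bailey_term q (Suc (Suc n)) s) = (\<Sum>s<Suc n. bailey_term q (Suc n) s)"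
    by simp
  have e1: "qpoch (- q) (q^2) (Suc (Suc n)) = qpoch (- q) (q^2) (Suc n) * (1 + q ^ (2 * Suc n + 1))"
    by (subst qpoch_Suc) (simp only: power_add power_mult power_one_right, simp)
  have e2: "qpoch (q^2) (q^2) (Suc n) = qpoch (q^2) (q^2) n * (1 - q ^ (2 * Suc n))"
    by (subst qpoch_Suc) (simp only: power_mult power_Suc2)
  have "qpoch (- q) (q^2) (Suc (Suc n)) * qpoch (q^2) (q^2) (Suc n) =
     ?c * (qpoch (- q) (q^2) (Suc n) * qpoch (q^2) (q^2) n)"
    unfolding e1 e2 by (simp only: mult_ac)
  hence "(\<Sum>s<Suc (Suc n). bailey_term q (Suc (Suc n)) s) *
      (qpoch (- q) (q^2) (Suc (Suc n)) * qpoch (q^2) (q^2) (Suc n)) =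
     (?c * (\<Sum>s<Suc (Suc n). bailey_term q (Suc (Suc n)) s)) * (qpoch (- q) (q^2) (Suc n) * qpoch (q^2) (q^2) n)"
    by (simp only: mult_ac)
  also have "\<dots> = 1" unfolding eq by (rule Suc.IH)
  finally show ?case .
qed

section \<open>Truncated theta sums and the Bailey pair\<close>

lemma norm_theta_mean_le: "norm (theta_mean q n) \<le> 2 * real n"
proof -
  have "norm ((-1) ^ k * q ^ (k^2) * (1 - q ^ (2 * k + 1))) \<le> 1 * 1 * (1 + 1)" for k
    unfolding norm_mult norm_power
    using q1 by (intro mult_mono order_trans[OF norm_triangle_ineq4] add_mono)
       (auto simp: norm_power norm_mult power_le_one mult_le_one)
  hence "norm (theta_mean q n) \<le> (\<Sum>k<n. 2)"
    unfolding theta_mean_def by (intro sum_norm_le) auto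
  thus ?thesis by simp
qed

lemma theta_mean_altdef:
  "theta_mean q n = (\<Sum>m\<in>{- int n..int n}. (-1) powi m * q powi (m^2)) - (-1) ^ n * q ^ (n^2)"
proof (induction n)
  case (Suc n)
  have "{- int (Suc n)..int (Suc n)} = insert (- int (Suc n)) (insert (int (Suc n)) {- int n..int n})"
    by auto
  moreover define f where "f = (\<lambda>m. (-1) powi m * q powi (m^2))"
  ultimately have "sum f {- int (Suc n)..int (Suc n)} =
      f (- int (Suc n)) + (f (int (Suc n)) + sum f {- int n..int n})"
    by simp
  moreover have "q powi ((int (Suc n))^2) = q ^ (Suc n)^2"
    using power_int_of_nat[of q "(Suc n)^2"] by (simp del: power_int_of_nat)
  hence "f (int (Suc n)) = (-1) ^ Suc n * q ^ (Suc n)^2"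
    unfolding f_def power_int_of_nat by simp
  moreover from this have "f (- int (Suc n)) = (-1) ^ Suc n * q ^ (Suc n)^2"
    unfolding f_def power_int_minus power2_minus power_int_of_nat by (simp flip: power_inverse)
  ultimately have "sum f {- int (Suc n)..int (Suc n)} =
      sum f {- int n..int n} + 2 * (-1) ^ Suc n * q ^ (Suc n)^2"
    by simp
  moreover have "(Suc n)^2 = n^2 + (2 * n + 1)"
    by (simp add: power2_eq_square)
  hence "q ^ (Suc n)^2 = q ^ (n^2) * q ^ (2 * n + 1)"
    by (simp only: power_add)
  ultimately show ?case
    using Suc.IH unfolding f_def by (simp add: theta_mean_def algebra_simps)
qed (simp add: theta_mean_def)

text \<open>Multiplied by 1 + q^(2n), the kernel against T_r becomes a difference in r, so summation
  by parts moves the difference onto T_r.\<close>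

lemma bailey_pair:
  "(1 + q ^ (2 * n)) *
     (\<Sum>r\<le>n. q ^ (r^2) * theta_mean q r *
       ((1 - q ^ (2 * r)) / q ^ r * (invpoch (q^2) (int n - int r) * invpoch (q^2) (int n + int r))))
   = (\<Sum>s<n. bailey_term q n s)"
proof -
  \<comment> \<open>Found from (1 + X^2)(1 - y^2) = (1 - X^2 y^2) - y^2 (1 - X^2/y^2) with X = q^n,
    y = q^r.\<close>
  define g where "g r = q ^ (r^2) / q ^ r * (invpoch (q^2) (int n - int r) * invpoch (q^2) (int n + int r - 1))" for r
  have *: "(1 + q ^ (2 * n)) * (q ^ (r^2) * theta_mean q r *
     ((1 - q ^ (2 * r)) / q ^ r * (invpoch (q^2) (int n - int r) * invpoch (q^2) (int n + int r)))) =
       (g r - g (Suc r)) * theta_mean q r" for r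
  proof -
    define X y J K where "X = q ^ n" and "y = q ^ r"
      and "J = invpoch (q^2) (int n - int r)" and "K = invpoch (q^2) (int n + int r)"
    have y: "y \<noteq> 0" using q0 by (simp add: y_def)
    have J: "invpoch (q^2) (int n - int r - 1) = (1 - X^2 / y^2) * J"
      unfolding J_def X_def y_def
      by (rule invpoch_downI)
         (use q0 in \<open>auto simp: power_int_diff power_int_mult power2_eq_square power_mult_distrib\<close>)
    have K: "invpoch (q^2) (int n + int r - 1) = (1 - X^2 * y^2) * K"
      unfolding K_def X_def y_def
      by (rule invpoch_downI)
         (use q0 in \<open>auto simp: power_int_add power_int_mult distrib_left mult_ac\<close>)
    have p: "q ^ (2 * r) = y^2" "q ^ (2 * n) = X^2" "q ^ Suc r = q * y"
        "q ^ (Suc r)^2 = q ^ (r^2) * y^2 * q"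
      by (simp_all add: y_def X_def power_add mult_2 power2_eq_square)
    have e: "int n - int (Suc r) = int n - int r - 1" "int n + int (Suc r) - 1 = int n + int r"
      by auto
    show ?thesis
      unfolding g_def e J K p J_def[symmetric] K_def[symmetric] y_def[symmetric]
      using y q0 by (simp add: field_simps)
  qed
  have **: "g (Suc s) * (theta_mean q (Suc s) - theta_mean q s) = bailey_term q n s" for s
  proof -
    have "(Suc s)^2 = s^2 + Suc s + s"
      by (simp add: power2_eq_square)
    hence "q ^ (Suc s)^2 = q ^ (s^2) * q ^ Suc s * q ^ s"
      by (simp only: power_add)
    moreover have "s * (2 * s + 1) = s^2 + s + s^2"
      by (simp add: power2_eq_square algebra_simps)
    hence "q ^ (s * (2 * s + 1)) = q ^ (s^2) * q ^ s * q ^ (s^2)"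
      by (simp only: power_add)
    moreover have e: "int n - int (Suc s) = int n - 1 - int s" "int n + int (Suc s) - 1 = int n + int s"
      by auto
    ultimately show ?thesis
      using q0 unfolding g_def bailey_term_def theta_mean_def e by simp
  qed
  \<comment> \<open>The upper boundary term vanishes by this, the lower one by T_0 = 0.\<close>
  have "g (Suc n) = 0" by (simp add: g_def)
  thus ?thesis
    unfolding sum_distrib_left * abel_summation ** by (simp add: theta_mean_def)
qed

lemma summand_expansion:
  assumes "0 < n" "n \<le> N"
  shows "summand q n = (\<Sum>r\<le>N. q ^ (r^2) * theta_mean q r * gauss_term q n r)"
proof -
  obtain m where n: "n = Suc m" using assms(1) by (cases n) auto
  define S where "S = (\<Sum>r\<le>n. q ^ (r^2) * theta_mean q r *
       ((1 - q ^ (2 * r)) / q ^ r * (invpoch (q^2) (int n - int r) * invpoch (q^2) (int n + int r))))"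
  have B: "(1 + q ^ (2 * n)) * S * (qpoch (- q) (q^2) n * qpoch (q^2) (q^2) m) = 1"
    using sum_bailey_term[of m] bailey_pair[of n] unfolding S_def n by simp
  \<comment> \<open>Since \<open>B\<close> exhibits an inverse, it also shows that the denominator
    is nonzero.\<close>
  have "inverse (qpoch (- q) (q^2) n * (1 + q ^ (2 * n))) = qpoch (q^2) (q^2) m * S"
    by (rule inverse_unique) (use B in \<open>simp only: mult_ac\<close>)
  hence "summand q n = gauss_weight q n * S"
    unfolding summand_def gauss_weight_def divide_inverse by (simp add: n mult_ac)
  also have "\<dots> = (\<Sum>r\<le>n. q ^ (r^2) * theta_mean q r * gauss_term q n r)"
    unfolding S_def sum_distrib_left gauss_term_def by (intro sum.cong) auto
  \<comment> \<open>Terms with r > n are 0; a range independent of n allows the sums over n and r to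
    be interchanged.\<close>
  also have "\<dots> = (\<Sum>r\<le>N. q ^ (r^2) * theta_mean q r * gauss_term q n r)"
    using assms by (intro sum.mono_neutral_left) (auto simp: gauss_term_def)
  finally show ?thesis .
qed

section \<open>Partial sums of the q-series and their error term\<close>

lemma summand_partial_sums:
  "(\<Sum>n=1..N. summand q n) = (\<Sum>r\<le>N. q ^ (r^2) * theta_mean q r) +
     (\<Sum>r\<le>N. q ^ (r^2) * theta_mean q r * (\<Sum>j<r. gauss_cert q (Suc N) j))"
proof -
  have "(\<Sum>n=1..N. summand q n) = (\<Sum>n=1..N. \<Sum>r\<le>N. q ^ (r^2) * theta_mean q r * gauss_term q n r)"
    by (intro sum.cong refl summand_expansion) auto
  also have "\<dots> = (\<Sum>r\<le>N. q ^ (r^2) * theta_mean q r * (\<Sum>n=1..N. gauss_term q n r))"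
    by (subst sum.swap) (simp add: sum_distrib_left)
  \<comment> \<open>At r = 0 the q-Gauss sum lacks its 1, but there it is multiplied by T_0 =
    0.\<close>
  also have "\<dots> = (\<Sum>r\<le>N. q ^ (r^2) * theta_mean q r + q ^ (r^2) * theta_mean q r * (\<Sum>j<r. gauss_cert q (Suc N) j))"
    unfolding sum_gauss_term by (intro sum.cong refl) (auto simp: algebra_simps theta_mean_def)
  finally show ?thesis by (simp add: sum.distrib)
qed

lemma gauss_weight_bounded:
  obtains C where "C > 0" "\<And>n. norm (gauss_weight q n) \<le> C * norm q ^ n"
proof -
  obtain C1 where C1: "C1 > 0" "\<And>n. norm (qpoch q (q^2) n) \<le> C1"
    using qpoch_bounded[OF norm_q2] by metis
  obtain C2 where C2: "C2 > 0" "\<And>n. norm (qpoch (q^2) (q^2) n) \<le> C2"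
    using qpoch_bounded[OF norm_q2] by metis
  have "norm (gauss_weight q n) \<le> norm q ^ n * C1 * C2" for n
    unfolding gauss_weight_def norm_mult norm_power
    using C1 C2 by (intro mult_mono) auto
  thus ?thesis using C1 C2 by (intro that[of "C1 * C2"]) (auto simp: mult_ac)
qed

text \<open>The weight decays like |q|^(N+1), and the certificate divides by q^(j+1). Weakening the
  exponent N - j to N - r makes the bound uniform in j.\<close>

lemma gauss_cert_bounded:
  obtains C where "C > 0" "\<And>N r j. j < r \<Longrightarrow> r \<le> N \<Longrightarrow> norm (gauss_cert q (Suc N) j) \<le> C * norm q ^ (N - r)"
proof -
  obtain C1 where C1: "C1 > 0" "\<And>n. norm (gauss_weight q n) \<le> C1 * norm q ^ n"
    using gauss_weight_bounded by metis
  obtain C2 where C2: "C2 > 0" "\<And>k. norm (invpoch (q^2) k) \<le> C2"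
    using invpoch_bounded[OF norm_q2] by metis
  have "norm (gauss_cert q (Suc N) j) \<le> (C1 * 2 * (C2 * C2)) * norm q ^ (N - r)" if "j < r" "r \<le> N" for N r j
  proof -
    have "norm (1 + q ^ (2 * j + 1)) \<le> 2"
      using norm_triangle_ineq[of 1 "q ^ (2 * j + 1)"] power_le_one[of "norm q" "2 * j + 1"] q1
      by (simp add: norm_power norm_mult)
    hence "norm (gauss_cert q (Suc N) j) \<le> (C1 * norm q ^ Suc N) * 2 / norm q ^ (j + 1) * (C2 * C2)"
      unfolding gauss_cert_def norm_mult norm_divide norm_minus_cancel norm_power
      using C1(1) C1(2)[of "Suc N"] C2 by (intro mult_mono divide_right_mono) auto
    also have "norm q ^ Suc N = norm q ^ (N - j) * norm q ^ (j + 1)"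
      using that by (simp flip: power_add)
    also have "(C1 * (norm q ^ (N - j) * norm q ^ (j + 1))) * 2 / norm q ^ (j + 1) * (C2 * C2) =
        (C1 * 2 * (C2 * C2)) * norm q ^ (N - j)"
      using q0 by simp
    also have "\<dots> \<le> (C1 * 2 * (C2 * C2)) * norm q ^ (N - r)"
      using C1 C2 q1 that by (intro mult_left_mono power_decreasing) auto
    finally show ?thesis .
  qed
  thus ?thesis using C1 C2 by (intro that[of "C1 * 2 * (C2 * C2)"]) auto
qed

lemma error_LIMSEQ:
  "(\<lambda>N. \<Sum>r\<le>N. q ^ (r^2) * theta_mean q r * (\<Sum>j<r. gauss_cert q (Suc N) j)) \<longlonglongrightarrow> 0"
proof -
  obtain C where C: "C > 0"
    "\<And>N r j. j < r \<Longrightarrow> r \<le> N \<Longrightarrow> norm (gauss_cert q (Suc N) j) \<le> C * norm q ^ (N - r)"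
    using gauss_cert_bounded by metis
  have "norm (\<Sum>r\<le>N. q ^ (r^2) * theta_mean q r * (\<Sum>j<r. gauss_cert q (Suc N) j))
    \<le> 2 * C * (real (Suc N) * real (Suc N) ^ 2 * norm q ^ N)" for N
  proof -
    have "norm (q ^ (r^2) * theta_mean q r * (\<Sum>j<r. gauss_cert q (Suc N) j)) \<le>
       2 * C * real N ^ 2 * norm q ^ N" if r: "r \<in> {..N}" for r
    proof -
      have "norm (\<Sum>j<r. gauss_cert q (Suc N) j) \<le> (\<Sum>j<r. C * norm q ^ (N - r))"
        using r by (intro sum_norm_le C) auto
      also have "\<dots> \<le> real N * (C * norm q ^ (N - r))"
        using r C by (auto intro!: mult_right_mono)
      \<comment> \<open>The bound |q|^r for q^(r^2) is just enough to restore |q|^(N-r) to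
        |q|^N.\<close>
      finally have "norm (q ^ (r^2) * theta_mean q r * (\<Sum>j<r. gauss_cert q (Suc N) j)) \<le>
         norm q ^ r * (2 * real N) * (real N * (C * norm q ^ (N - r)))"
        unfolding norm_mult norm_power
        using r C q1 norm_theta_mean_le[of r]
        by (intro mult_mono power_decreasing)
          (auto intro: order_trans mult_right_mono simp: power2_eq_square)
      also have "\<dots> = 2 * C * real N ^ 2 * (norm q ^ r * norm q ^ (N - r))"
        by (simp add: power2_eq_square)
      also have "norm q ^ r * norm q ^ (N - r) = norm q ^ N"
        using r by (simp flip: power_add)
      finally show ?thesis .
    qed
    hence "norm (\<Sum>r\<le>N. q ^ (r^2) * theta_mean q r * (\<Sum>j<r. gauss_cert q (Suc N) j)) \<le>
       (\<Sum>r\<le>N. 2 * C * real N ^ 2 * norm q ^ N)"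
      by (rule sum_norm_le)
    also have "\<dots> = 2 * C * (real (Suc N) * real N ^ 2 * norm q ^ N)"
      by simp
    also have "\<dots> \<le> 2 * C * (real (Suc N) * real (Suc N) ^ 2 * norm q ^ N)"
      using C by (intro mult_left_mono mult_right_mono power_mono) auto
    finally show ?thesis .
  qed
  moreover have "(\<lambda>N. 2 * C * (real (Suc N) * real (Suc N) ^ 2 * norm q ^ N)) \<longlonglongrightarrow> 0"
    using q0 q1 by real_asymp
  ultimately show ?thesis by (rule Lim_null_comparison[OF always_eventually, OF allI])
qed

section \<open>Absolute convergence of the q-series\<close>

lemma summand_bounded:
  obtains C where "C > 0" "\<And>n. n \<ge> 1 \<Longrightarrow> norm (summand q n) \<le> C * norm q ^ n"
proof -
  obtain C1 where C1: "C1 > 0" "\<And>n. norm (qpoch q (q^2) n) \<le> C1"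
    using qpoch_bounded[OF norm_q2] by metis
  have "(q^2) ^ i * (-q) \<noteq> 1" for i
    using power_neq_one(2)[OF q1, of "2 * i + 1"]
    by (metis (no_types, opaque_lifting) add.inverse_inverse mult_minus_right power_add power_mult power_one_right
      zero_less_Suc Suc_eq_plus1)
  then obtain C2 where C2: "C2 > 0" "\<And>n. norm (inverse (qpoch (-q) (q^2) n)) \<le> C2"
    using inverse_qpoch_bounded[OF norm_q2] by metis
  have "norm (summand q n) \<le> C1 * C2 * inverse (1 - norm q) * norm q ^ n" if "n \<ge> 1" for n
  proof -
    \<comment> \<open>For n > 0 this keeps 1 + q^(2n) away from 0 uniformly in n.\<close>
    have "1 - norm q \<le> 1 - norm q ^ (2 * n)"
      using q1 that power_decreasing[of 1 "2 * n" "norm q"] by auto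
    also have "\<dots> \<le> norm (1 + q ^ (2 * n))"
      using norm_triangle_ineq2[of 1 "- (q ^ (2 * n))"] by (simp add: norm_power)
    finally have "inverse (norm (1 + q ^ (2 * n))) \<le> inverse (1 - norm q)"
      using q1 by (intro le_imp_inverse_le) auto
    hence "norm (summand q n) \<le> norm q ^ n * C1 * (C2 * inverse (1 - norm q))"
      unfolding summand_def divide_inverse inverse_mult_distrib norm_mult norm_power
      using C1 C2 q1 unfolding norm_inverse
      by (intro mult_mono) auto
    thus ?thesis by (simp add: mult_ac)
  qed
  thus ?thesis using C1 C2 q1 by (intro that[of "C1 * C2 * inverse (1 - norm q)"]) auto
qed

lemma summand_summable: "summand q summable_on {1..}"
proof -
  obtain C where C: "C > 0" "\<And>n. n \<ge> 1 \<Longrightarrow> norm (summand q n) \<le> C * norm q ^ n"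
    using summand_bounded by metis
  have "(\<lambda>n. C * norm q ^ n) summable_on {1..}"
    by (rule summable_on_subset_banach[OF norm_summable_imp_summable_on])
       (use q1 in \<open>auto simp: abs_mult intro!: summable_mult summable_geometric\<close>)
  thus ?thesis
    by (rule abs_summable_summable[OF Infinite_Sum.abs_summable_on_comparison_test']) (use C in auto)
qed

end

section \<open>The theta function\<close>

text \<open>Times (p^2; p^2)_(2n), this is (-1)^r p^(r^2) times the Gaussian binomial coefficient of
  2n over n + r in base p^2.\<close>

definition triple_term :: "complex \<Rightarrow> nat \<Rightarrow> nat \<Rightarrow> complex" where
  "triple_term p n r = (-1) ^ r * p ^ (r^2) * (invpoch (p^2) (int n - int r) * invpoch (p^2) (int n + int r))"

text \<open>Read for all integers r, this expression is antisymmetric under r -> 1 - r; its values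
  at 0 and 1 are therefore opposite.\<close>

definition triple_cert :: "complex \<Rightarrow> nat \<Rightarrow> nat \<Rightarrow> complex" where
  "triple_cert p n r = - ((-1) ^ r * p ^ (r^2)) * (1 - p ^ (2 * n + 1)) * p ^ (2 * n + 1) * (1 + p / p ^ (2 * r)) *
     (invpoch (p^2) (int n + 1 - int r) * invpoch (p^2) (int n + int r))"

text \<open>The sum over \<open>-n \<le> r \<le> n\<close>, folded by the symmetry \<open>r \<leftrightarrow> -r\<close>.\<close>

definition triple_sum :: "complex \<Rightarrow> nat \<Rightarrow> complex" where
  "triple_sum p n = 2 * (\<Sum>r\<le>n. triple_term p n r) - triple_term p n 0"

context
  fixes p :: complex
  assumes p0: "p \<noteq> 0" and p1: "norm p < 1"
begin

lemma triple_term_diff: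
  "(1 - (p^2) ^ (2 * n + 1)) * (1 - (p^2) ^ (2 * n + 2)) * triple_term p (Suc n) r
     - (1 - p ^ (2 * n + 1))^2 * triple_term p n r = triple_cert p n (Suc r) - triple_cert p n r"
proof -
  define X y J K E where "X = p ^ n" and "y = p ^ r"
    and "J = invpoch (p^2) (int n + 1 - int r)" and "K = invpoch (p^2) (int n + int r + 1)"
    and "E = (-1) ^ r * p ^ (r^2)"
  have y: "y \<noteq> 0" using p0 by (simp add: y_def)
  have J: "invpoch (p^2) (int n - int r) = (1 - X^2 * p^2 / y^2) * J"
    unfolding J_def X_def y_def
    by (rule invpoch_downI[OF p0 p1])
       (use p0 in \<open>auto simp: power_int_diff power_int_add power_int_mult power2_eq_square power_mult_distrib\<close>)
  have K: "invpoch (p^2) (int n + int r) = (1 - X^2 * y^2 * p^2) * K"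
    unfolding K_def X_def y_def
    by (rule invpoch_downI[OF p0 p1])
       (use p0 in \<open>auto simp: power_int_add power_int_mult distrib_left mult_ac\<close>)
  have E: "(-1) ^ Suc r * p ^ (Suc r)^2 = - E * y^2 * p"
    by (simp add: E_def y_def power_add power2_eq_square)
  have q: "p ^ (2 * r) = y^2" "p ^ (2 * Suc r) = p^2 * y^2" "p ^ (2 * n + 1) = p * X^2"
     "(p^2) ^ (2 * n + 1) = p^2 * X^4" "(p^2) ^ (2 * n + 2) = p^4 * X^4"
    by (simp_all add: y_def X_def power_add mult_2 power2_eq_square power4_eq_xxxx power_mult_distrib)
  have e: "int (Suc n) - int r = int n + 1 - int r" "int (Suc n) + int r = int n + int r + 1"
    "int n + 1 - int (Suc r) = int n - int r" "int n + int (Suc r) = int n + int r + 1"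
    by auto
  show ?thesis
    unfolding triple_term_def triple_cert_def e J K E q J_def[symmetric] K_def[symmetric] E_def[symmetric]
    using y p0 by (simp add: field_simps) algebra
qed

text \<open>Both sides satisfy the same first-order recurrence in n, which for the sum comes from
  the certificate.\<close>

lemma finite_triple_product: "triple_sum p n * qpoch (p^2) (p^2) (2 * n) = (qpoch p (p^2) n)^2"
proof (induction n)
  case 0
  thus ?case by (simp add: triple_sum_def triple_term_def)
next
  case (Suc n)
  let ?c = "(1 - (p^2) ^ (2 * n + 1)) * (1 - (p^2) ^ (2 * n + 2))" and ?d = "(1 - p ^ (2 * n + 1))^2"
  have "?c * (\<Sum>r\<le>Suc n. triple_term p (Suc n) r) - ?d * (\<Sum>r\<le>Suc n. triple_term p n r) =
     (\<Sum>r<Suc (Suc n). triple_cert p n (Suc r) - triple_cert p n r)"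
    unfolding sum_distrib_left sum_subtractf[symmetric] lessThan_Suc_atMost
    by (intro sum.cong refl triple_term_diff)
  also have "\<dots> = triple_cert p n (Suc (Suc n)) - triple_cert p n 0"
    by (rule sum_lessThan_telescope)
  also have "\<dots> = - triple_cert p n 0"
    by (simp add: triple_cert_def)
  also have "(\<Sum>r\<le>Suc n. triple_term p n r) = (\<Sum>r\<le>n. triple_term p n r)"
    by (simp add: triple_term_def)
  finally have 1: "?c * (\<Sum>r\<le>Suc n. triple_term p (Suc n) r) - ?d * (\<Sum>r\<le>n. triple_term p n r) = - triple_cert p n 0" .
  \<comment> \<open>Summing over r \<ge> 0 leaves the boundary value at r = 0. Folding doubles it
    and subtracts the r = 0 equation, whose right side is, by antisymmetry, the same doubled value;
    the two cancel.\<close>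
  have "triple_cert p n (Suc 0) = - triple_cert p n 0"
    using p0 by (simp add: triple_cert_def add_ac field_simps power2_eq_square)
  hence 2: "?c * triple_term p (Suc n) 0 - ?d * triple_term p n 0 = - 2 * triple_cert p n 0"
    using triple_term_diff[of n 0] by simp
  have rec: "?c * triple_sum p (Suc n) = ?d * triple_sum p n"
  proof -
    have "?c * triple_sum p (Suc n) - ?d * triple_sum p n =
       2 * (?c * (\<Sum>r\<le>Suc n. triple_term p (Suc n) r) - ?d * (\<Sum>r\<le>n. triple_term p n r)) -
       (?c * triple_term p (Suc n) 0 - ?d * triple_term p n 0)"
      unfolding triple_sum_def
      by (simp only: right_diff_distrib mult.left_commute[of 2] diff_diff_eq2 diff_add_eq)
         (simp add: algebra_simps)
    also have "\<dots> = 0" unfolding 1 2 by simp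
    finally show ?thesis by simp
  qed
  have "2 * Suc n = Suc (Suc (2 * n))" by simp
  hence "qpoch (p^2) (p^2) (2 * Suc n) = ?c * qpoch (p^2) (p^2) (2 * n)"
    by (simp only: qpoch_Suc) (simp add: mult_ac)
  hence "triple_sum p (Suc n) * qpoch (p^2) (p^2) (2 * Suc n) = (?c * triple_sum p (Suc n)) * qpoch (p^2) (p^2) (2 * n)"
    by simp
  also have "\<dots> = ?d * (triple_sum p n * qpoch (p^2) (p^2) (2 * n))"
    unfolding rec by simp
  also have "\<dots> = (qpoch p (p^2) (Suc n))^2"
  proof -
    have e: "p ^ (2 * n + 1) = (p^2) ^ n * p"
      by (simp only: power_add power_mult power_one_right)
    show ?thesis
      unfolding Suc.IH qpoch_Suc e by (simp only: power_mult_distrib mult_ac)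
  qed
  finally show ?case .
qed

section \<open>The limit of the finite triple product\<close>

lemma p_power2_summable: "summable (\<lambda>r. norm ((-1) ^ r * p ^ (r^2)))"
proof (rule summable_comparison_test')
  show "summable (\<lambda>r. norm p ^ r)" using p1 by (simp add: summable_geometric)
  fix r :: nat
  show "norm (norm ((-1) ^ r * p ^ (r^2))) \<le> norm p ^ r"
    using p1 by (auto simp: norm_mult norm_power power2_eq_square intro!: power_decreasing)
qed

text \<open>Tannery's theorem applies to the finite product formula: the reciprocal factorials are
  bounded uniformly and tend to 1/\<open>P\<close>. As p^2/p = p, the two variable factors of the
  theta function coincide, which yields the square.\<close>

lemma theta_j_eq: "theta_j p (p^2) = 2 * (\<Sum>r. (-1) ^ r * p ^ (r^2)) - 1"
proof -
  define P where "P = qpoch_inf (p^2) (p^2)"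
  define w where "w r = (-1) ^ r * p ^ (r^2) * (inverse P * inverse P)" for r
  note p2 = norm_q2[OF p0 p1]
  have Pnz: "P \<noteq> 0"
    unfolding P_def using p2
  proof (rule qpoch_inf_nonzero)
    show "(p\<^sup>2) ^ i * p\<^sup>2 \<noteq> 1" for i
      using power_neq_one(1)[OF p2, of "Suc i"] by (simp add: mult.commute)
  qed
  have lim: "(\<lambda>n. triple_term p n r) \<longlonglongrightarrow> w r" for r
  proof -
    have "filterlim (\<lambda>n. int n - int r) at_top sequentially"
      "filterlim (\<lambda>n. int n + int r) at_top sequentially"
      unfolding filterlim_at_top eventually_sequentially by (intro allI, rule_tac x = "nat (Z + int r)" in exI, force)+
    thus ?thesis
      unfolding triple_term_def w_def P_def by (intro tendsto_intros invpoch_LIMSEQ p2)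
  qed
  obtain C where C: "C > 0" "\<And>k. norm (invpoch (p^2) k) \<le> C"
    using invpoch_bounded[OF p2] by metis
  have bound: "norm (triple_term p n r) \<le> norm ((-1) ^ r * p ^ (r^2)) * (C * C)" for n r
    unfolding triple_term_def norm_mult using C by (intro mult_mono) auto
  have "eventually (\<lambda>n. summable (\<lambda>r. norm (triple_term p n r))) sequentially \<and>
      summable (\<lambda>r. norm (w r)) \<and> (\<lambda>n. suminf (triple_term p n)) \<longlonglongrightarrow> suminf w"
  proof (rule tannerys_theorem)
    show "summable (\<lambda>r. norm ((-1) ^ r * p ^ (r^2)) * (C * C))"
      by (intro summable_mult2 p_power2_summable)
    show "\<forall>\<^sub>F (r, n) in sequentially \<times>\<^sub>F sequentially. norm (triple_term p n r) \<le> norm ((-1) ^ r * p ^ (r^2)) * (C * C)"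
      using bound by (auto intro!: always_eventually)
  qed (use lim in auto)
  hence "(\<lambda>n. suminf (triple_term p n)) \<longlonglongrightarrow> suminf w" by blast
  moreover have "suminf (triple_term p n) = (\<Sum>r\<le>n. triple_term p n r)" for n
    by (intro suminf_finite) (auto simp: triple_term_def)
  ultimately have "triple_sum p \<longlonglongrightarrow> 2 * suminf w - w 0"
    unfolding triple_sum_def by (intro tendsto_intros lim) simp
  moreover have "suminf w = (\<Sum>r. (-1) ^ r * p ^ (r^2)) * (inverse P * inverse P)"
    unfolding w_def by (rule suminf_mult2[symmetric, OF summable_norm_cancel[OF p_power2_summable]])
  moreover have "w 0 = inverse P * inverse P" by (simp add: w_def)
  ultimately have "triple_sum p \<longlonglongrightarrow> (2 * (\<Sum>r. (-1) ^ r * p ^ (r^2)) - 1) * (inverse P * inverse P)"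
    by (simp add: algebra_simps)
  moreover have "(\<lambda>n. qpoch (p^2) (p^2) (2 * n)) \<longlonglongrightarrow> P"
    unfolding P_def
    by (rule filterlim_compose[OF qpoch_LIMSEQ[OF p2]])
       (auto intro!: filterlim_subseq simp: strict_mono_def)
  ultimately have "(\<lambda>n. (qpoch p (p^2) n)^2) \<longlonglongrightarrow>
      (2 * (\<Sum>r. (-1) ^ r * p ^ (r^2)) - 1) * (inverse P * inverse P) * P"
    unfolding finite_triple_product[symmetric] by (rule tendsto_mult)
  moreover have "(\<lambda>n. (qpoch p (p^2) n)^2) \<longlonglongrightarrow> (qpoch_inf p (p^2))^2"
    by (intro tendsto_intros qpoch_LIMSEQ p2)
  ultimately have "(qpoch_inf p (p^2))^2 = (2 * (\<Sum>r. (-1) ^ r * p ^ (r^2)) - 1) * (inverse P * inverse P) * P"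
    by (rule LIMSEQ_unique[symmetric])
  hence "(qpoch_inf p (p^2))^2 * P = 2 * (\<Sum>r. (-1) ^ r * p ^ (r^2)) - 1"
    using right_inverse[OF Pnz] by algebra
  moreover have "p\<^sup>2 / p = p" using p0 by (simp add: power2_eq_square)
  ultimately show ?thesis
    unfolding theta_j_def P_def[symmetric] by (simp add: power2_eq_square)
qed

end

section \<open>The double sums\<close>

definition alt_square :: "complex \<Rightarrow> nat \<Rightarrow> complex" where
  "alt_square q k = (-1) ^ k * q ^ (2 * k^2)"

definition alt_oblong :: "complex \<Rightarrow> nat \<Rightarrow> complex" where
  "alt_oblong q k = (-1) ^ k * q ^ (2 * k * (k + 1))"

definition hecke_term :: "complex \<Rightarrow> nat \<times> int \<Rightarrow> complex" where
  "hecke_term q = (\<lambda>(n, m). (-1) powi m * q powi ((int n)^2 + m^2))"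

context
  fixes q :: complex
  assumes q0: "q \<noteq> 0" and q1: "norm q < 1"
begin

lemma geometric_summable_on: "(\<lambda>n. norm q ^ n) summable_on A"
  by (rule summable_on_subset_banach[OF norm_summable_imp_summable_on])
     (use q1 in \<open>auto intro!: summable_geometric\<close>)

lemma alt_square_abs_summable: "(\<lambda>k. norm (alt_square q k)) summable_on A"
proof (rule summable_on_comparison_test[OF geometric_summable_on])
  show "norm (alt_square q k) \<le> norm q ^ k" for k
    unfolding alt_square_def norm_mult norm_power using q1
    by (auto intro!: power_decreasing simp: power2_eq_square)
qed auto

lemma alt_square_summable: "alt_square q summable_on A"
  by (rule abs_summable_summable[OF alt_square_abs_summable])

lemma alt_oblong_abs_summable: "(\<lambda>k. norm (alt_oblong q k)) summable_on A"
proof (rule summable_on_comparison_test[OF geometric_summable_on])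
  show "norm (alt_oblong q k) \<le> norm q ^ k" for k
    unfolding alt_oblong_def norm_mult norm_power using q1
    by (auto intro!: power_decreasing)
qed auto

lemma infsum_alt_square: "infsum (alt_square q) UNIV = 1 + infsum (alt_square q) {1..}"
proof -
  have "(alt_square q has_sum (sum (alt_square q) {0} + infsum (alt_square q) {1..})) ({0} \<union> {1..})"
    by (rule has_sum_Un_disjoint[OF has_sum_finite has_sum_infsum[OF alt_square_summable]]) auto
  moreover have "{0} \<union> {1..} = (UNIV :: nat set)" by auto
  ultimately show ?thesis by (simp add: infsumI alt_square_def)
qed

section \<open>The sums g_{1,0,1} as squares of one-variable series\<close>

lemma powi_binom2: "(q^4) powi binom2 r = q powi (2 * r * (r - 1))"
proof -
  have "(q^4) powi binom2 r = q powi (4 * binom2 r)"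
    by (simp add: power_int_mult)
  also have "4 * binom2 r = 2 * r * (r - 1)"
    using double_binom2[of r] by simp
  finally show ?thesis .
qed

text \<open>The one-variable factor (-1)^r q^(2r^2) is even in r, so the negative quadrant repeats
  the series without its k = 0 term.\<close>

lemma g_sum_alt_square:
  "g_sum 1 0 1 (q^2) (q^2) (q^4) = (infsum (alt_square q) UNIV)^2 + (infsum (alt_square q) {1..})^2"
proof -
  define f where "f = (\<lambda>r. (-1) powi r * (q^2) powi r * (q^4) powi binom2 r)"
  have f: "f r = (-1) powi r * q powi (2 * r^2)" for r
  proof -
    have "(q^2) powi r = q powi (2 * r)" by (simp add: power_int_mult)
    moreover have "q powi (2 * r) * q powi (2 * r * (r - 1)) = q powi (2 * r^2)"
      using q0 by (simp add: power2_eq_square algebra_simps flip: power_int_add)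
    ultimately show ?thesis unfolding f_def powi_binom2 mult.assoc by simp
  qed
  have p: "q powi (2 * (int k)^2) = q ^ (2 * k^2)" for k
    using power_int_of_nat[of q "2 * k^2"] by (simp del: power_int_of_nat)
  have f1: "f (int k) = alt_square q k" for k
    unfolding f alt_square_def p by simp
  have f2: "f (- int k) = alt_square q k" for k
    unfolding f alt_square_def power2_minus p by (simp add: power_int_minus flip: power_inverse)
  have "g_sum 1 0 1 (q^2) (q^2) (q^4) = (infsum f {0..})^2 + (infsum f {..<0})^2"
  proof (rule g_sum_diagonal[OF f_def])
    show "(\<lambda>r. norm (f r)) summable_on {0..}"
      using alt_square_abs_summable
      unfolding summable_on_reindex_bij_betw[OF bij_betw_int_nonneg, symmetric] f1 .
    show "(\<lambda>r. norm (f r)) summable_on {..<0}"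
      using alt_square_abs_summable
      unfolding summable_on_reindex_bij_betw[OF bij_betw_int_neg, symmetric] f2 .
  qed (use q0 in auto)
  also have "infsum f {0..} = infsum (alt_square q) UNIV"
    unfolding infsum_reindex_bij_betw[OF bij_betw_int_nonneg, symmetric] f1 ..
  also have "infsum f {..<0} = infsum (alt_square q) {1..}"
    unfolding infsum_reindex_bij_betw[OF bij_betw_int_neg, symmetric] f2 ..
  finally show ?thesis .
qed

text \<open>The one-variable factor (-1)^r q^(2r(r+1)) changes sign under r -> -1 - r, so both
  quadrants give the same square.\<close>

lemma g_sum_alt_oblong: "g_sum 1 0 1 (q^4) (q^4) (q^4) = 2 * (infsum (alt_oblong q) UNIV)^2"
proof -
  define f where "f = (\<lambda>r. (-1) powi r * (q^4) powi r * (q^4) powi binom2 r)"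
  have f: "f r = (-1) powi r * q powi (2 * r * (r + 1))" for r
  proof -
    have "(q^4) powi r = q powi (4 * r)" by (simp add: power_int_mult)
    moreover have "q powi (4 * r) * q powi (2 * r * (r - 1)) = q powi (2 * r * (r + 1))"
      using q0 by (simp add: algebra_simps flip: power_int_add)
    ultimately show ?thesis unfolding f_def powi_binom2 mult.assoc by simp
  qed
  have p: "q powi (2 * int k * (int k + 1)) = q ^ (2 * k * (k + 1))" for k
  proof -
    have "2 * int k * (int k + 1) = int (2 * k * (k + 1))" by (simp add: algebra_simps)
    thus ?thesis by (simp only: power_int_of_nat)
  qed
  have f1: "f (int k) = alt_oblong q k" for k
    unfolding f alt_oblong_def p by simp
  have f2: "f (- 1 - int k) = - alt_oblong q k" for k
  proof -
    have "2 * (- 1 - int k) * (- 1 - int k + 1) = 2 * int k * (int k + 1)"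
      by (simp add: algebra_simps)
    moreover have "(-1) powi (- 1 - int k) = - ((-1) ^ k :: complex)"
      by (cases "even k") (simp_all add: power_int_diff)
    ultimately show ?thesis
      unfolding f alt_oblong_def by (simp only: p mult_minus_left)
  qed
  have "g_sum 1 0 1 (q^4) (q^4) (q^4) = (infsum f {0..})^2 + (infsum f {..<0})^2"
  proof (rule g_sum_diagonal[OF f_def])
    show "(\<lambda>r. norm (f r)) summable_on {0..}"
      using alt_oblong_abs_summable
      unfolding summable_on_reindex_bij_betw[OF bij_betw_int_nonneg, symmetric] f1 .
    show "(\<lambda>r. norm (f r)) summable_on {..<0}"
      using alt_oblong_abs_summable
      unfolding summable_on_reindex_bij_betw[OF bij_betw_int_neg_shift, symmetric] f2 norm_minus_cancel .
  qed (use q0 in auto)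
  also have "infsum f {0..} = infsum (alt_oblong q) UNIV"
    unfolding infsum_reindex_bij_betw[OF bij_betw_int_nonneg, symmetric] f1 ..
  also have "infsum f {..<0} = - infsum (alt_oblong q) UNIV"
    unfolding infsum_reindex_bij_betw[OF bij_betw_int_neg_shift, symmetric] f2 infsum_uminus ..
  finally show ?thesis by simp
qed

lemma theta_j_eq_infsum: "theta_j (q^2) (q^4) = 2 * infsum (alt_square q) UNIV - 1"
proof -
  have q2: "q^2 \<noteq> 0" "norm (q^2) < 1" using q0 norm_q2[OF q0 q1] by auto
  have "alt_square q sums infsum (alt_square q) UNIV"
    by (rule has_sum_imp_sums[OF has_sum_infsum[OF alt_square_summable]])
  moreover have "alt_square q = (\<lambda>r. (-1) ^ r * (q^2) ^ (r^2))"
    by (simp add: alt_square_def power_mult fun_eq_iff)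
  ultimately have "(\<Sum>r. (-1) ^ r * (q^2) ^ (r^2)) = infsum (alt_square q) UNIV"
    by (simp add: sums_iff)
  thus ?thesis using theta_j_eq[OF q2] by (simp flip: power_mult)
qed

section \<open>The indefinite double sum, split by the parity of n + m\<close>

lemma hecke_term_even: "hecke_term q (r + s, int r - int s) = alt_square q r * alt_square q s"
proof -
  have "(int (r + s))^2 + (int r - int s)^2 = int (2 * r^2 + 2 * s^2)"
    by (simp add: power2_eq_square algebra_simps)
  moreover have "(-1) powi (int r - int s) = ((-1) ^ r * (-1) ^ s :: complex)"
    by (simp add: power_int_diff divide_inverse flip: power_inverse)
  ultimately show ?thesis
    unfolding hecke_term_def alt_square_def prod.case by (simp only: power_int_of_nat power_add mult_ac)
qed

lemma hecke_term_odd: "hecke_term q (r + s + 1, int r - int s) = q * (alt_oblong q r * alt_oblong q s)"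
proof -
  have "(int (r + s + 1))^2 + (int r - int s)^2 = int (2 * r * (r + 1) + 2 * s * (s + 1) + 1)"
    by (simp add: power2_eq_square algebra_simps)
  moreover have "(-1) powi (int r - int s) = ((-1) ^ r * (-1) ^ s :: complex)"
    by (simp add: power_int_diff divide_inverse flip: power_inverse)
  ultimately show ?thesis
    unfolding hecke_term_def alt_oblong_def prod.case by (simp only: power_int_of_nat power_add mult_ac power_one_right)
qed

lemma hecke_term_has_sum:
  "(hecke_term q has_sum ((infsum (alt_square q) UNIV)^2 + q * (infsum (alt_oblong q) UNIV)^2))
     (SIGMA n:UNIV. {- int n..int n})"
proof -
  define Ev where "Ev = {(n, m). \<bar>m\<bar> \<le> int n \<and> even (int n + m)}"
  define Od where "Od = {(n, m). \<bar>m\<bar> \<le> int n \<and> odd (int n + m)}"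
  have "((\<lambda>(r, s). alt_square q r * alt_square q s) has_sum (infsum (alt_square q) UNIV)^2) (UNIV \<times> UNIV)"
    unfolding power2_eq_square by (intro has_sum_product alt_square_abs_summable)
  also have "?this \<longleftrightarrow> (hecke_term q has_sum (infsum (alt_square q) UNIV)^2) Ev"
  \<comment> \<open>For n + m even, |m| \<le> n says precisely that (n+m)/2 and (n-m)/2 are natural
    numbers.\<close>
  proof (rule has_sum_reindex_bij_witness
         [where j = "\<lambda>(r, s). (r + s, int r - int s)"
            and i = "\<lambda>(n, m). (nat ((int n + m) div 2), nat ((int n - m) div 2))"], goal_cases)
    case (3 b)
    then obtain n m where "b = (n, m)" "\<bar>m\<bar> \<le> int n" and nm: "even (int n + m)"
      unfolding Ev_def by auto
    moreover from nm obtain c where "int n + m = 2 * c"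
      by (rule evenE)
    moreover from this have "m = 2 * c - int n" "int n - m = 2 * (int n - c)" by auto
    ultimately show ?case by auto
  qed (auto simp: Ev_def hecke_term_even)
  finally have 1: "(hecke_term q has_sum (infsum (alt_square q) UNIV)^2) Ev" .
  have "((\<lambda>(r, s). alt_oblong q r * alt_oblong q s) has_sum (infsum (alt_oblong q) UNIV)^2) (UNIV \<times> UNIV)"
    unfolding power2_eq_square by (intro has_sum_product alt_oblong_abs_summable)
  hence "((\<lambda>x. q * (case x of (r, s) \<Rightarrow> alt_oblong q r * alt_oblong q s)) has_sum (q * (infsum (alt_oblong q) UNIV)^2)) (UNIV \<times> UNIV)"
    by (rule has_sum_cmult_right)
  also have "?this \<longleftrightarrow> (hecke_term q has_sum (q * (infsum (alt_oblong q) UNIV)^2)) Od"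
  \<comment> \<open>Odd parity excludes |m| = n, so n - 1 + m and n - 1 - m are even and
    nonnegative.\<close>
  proof (rule has_sum_reindex_bij_witness
         [where j = "\<lambda>(r, s). (r + s + 1, int r - int s)"
            and i = "\<lambda>(n, m). (nat ((int n - 1 + m) div 2), nat ((int n - 1 - m) div 2))"], goal_cases)
    case (3 b)
    then obtain n m where "b = (n, m)" "\<bar>m\<bar> \<le> int n" and nm: "odd (int n + m)"
      unfolding Od_def by auto
    moreover from nm obtain c where "int n + m = 2 * c + 1"
      by (rule oddE)
    moreover from this have "m = 2 * c + 1 - int n" "int n - 1 - m = 2 * (int n - 1 - c)" by auto
    ultimately show ?case by auto
  qed (auto simp: Od_def hecke_term_odd[simplified])
  finally have 2: "(hecke_term q has_sum (q * (infsum (alt_oblong q) UNIV)^2)) Od" .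
  have "Ev \<inter> Od = {}" "Ev \<union> Od = (SIGMA n:UNIV. {- int n..int n})"
    by (auto simp: Ev_def Od_def)
  thus ?thesis using has_sum_Un_disjoint[OF 1 2] by simp
qed

lemma hecke_rows_has_sum:
  "((\<lambda>n. \<Sum>m\<in>{- int n..int n}. (-1) powi m * q powi ((int n)^2 + m^2)) has_sum
     ((infsum (alt_square q) UNIV)^2 + q * (infsum (alt_oblong q) UNIV)^2 - 1)) {1..}"
proof -
  let ?f = "\<lambda>n. \<Sum>m\<in>{- int n..int n}. (-1) powi m * q powi ((int n)^2 + m^2)"
  have "(?f has_sum ((infsum (alt_square q) UNIV)^2 + q * (infsum (alt_oblong q) UNIV)^2)) UNIV"
    by (rule has_sum_SigmaD[OF hecke_term_has_sum]) (auto simp: hecke_term_def)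
  \<comment> \<open>Removing the row n = 0, whose only term is 1, produces the -1 in the final
    formulas.\<close>
  moreover have "(?f has_sum 1) {0}"
    by (rule has_sum_finiteI) auto
  ultimately have "(?f has_sum ((infsum (alt_square q) UNIV)^2 + q * (infsum (alt_oblong q) UNIV)^2 - 1)) (UNIV - {0})"
    by (rule has_sum_Diff) auto
  moreover have "UNIV - {0} = {1::nat..}" by auto
  ultimately show ?thesis by simp
qed

lemma summand_infsum:
  "infsum (summand q) {1..} =
     (\<Sum>\<^sub>\<infinity>n::nat\<in>{1..}. \<Sum>m\<in>{- int n..int n}. (-1) powi m * q powi ((int n)^2 + m^2)) - infsum (alt_square q) {1..}"
proof -
  let ?f = "\<lambda>n. \<Sum>m\<in>{- int n..int n}. (-1) powi m * q powi ((int n)^2 + m^2)"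
  \<comment> \<open>The correction -(-1)^n q^(n^2) in T_n picks up another q^(n^2) and becomes the
    subtracted single series.\<close>
  have row: "q ^ (n^2) * theta_mean q n = ?f n - alt_square q n" for n
  proof -
    have "q powi ((int n)^2 + m^2) = q ^ (n^2) * q powi (m^2)" for m
      using q0 power_int_of_nat[of q "n^2"] by (simp add: power_int_add del: power_int_of_nat)
    hence "?f n = q ^ (n^2) * (\<Sum>m\<in>{- int n..int n}. (-1) powi m * q powi (m^2))"
      by (simp add: sum_distrib_left mult_ac)
    moreover have "alt_square q n = q ^ (n^2) * ((-1) ^ n * q ^ (n^2))"
      by (simp add: alt_square_def mult_2 power_add)
    ultimately show ?thesis
      by (simp add: theta_mean_altdef[OF q0 q1] right_diff_distrib)
  qed
  have "(\<Sum>r\<le>N. q ^ (r^2) * theta_mean q r) = (\<Sum>n=1..N. ?f n) - (\<Sum>n=1..N. alt_square q n)" for N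
  proof -
    have "(\<Sum>r\<le>N. q ^ (r^2) * theta_mean q r) = (\<Sum>r=1..N. q ^ (r^2) * theta_mean q r)"
      by (rule sum.mono_neutral_right) (auto simp: theta_mean_def not_less_eq_eq)
    thus ?thesis by (simp only: row sum_subtractf)
  qed
  hence "(\<lambda>N. \<Sum>n=1..N. summand q n) = (\<lambda>N. (\<Sum>n=1..N. ?f n) - (\<Sum>n=1..N. alt_square q n) +
     (\<Sum>r\<le>N. q ^ (r^2) * theta_mean q r * (\<Sum>j<r. gauss_cert q (Suc N) j)))"
    unfolding summand_partial_sums[OF q0 q1] by simp
  also have "\<dots> \<longlonglongrightarrow> infsum ?f {1..} - infsum (alt_square q) {1..} + 0"
    by (intro tendsto_intros infsum_atLeast_1_LIMSEQ error_LIMSEQ[OF q0 q1]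
        has_sum_imp_summable[OF hecke_rows_has_sum] alt_square_summable)
  finally show ?thesis
    using infsum_atLeast_1_LIMSEQ[OF summand_summable[OF q0 q1]] LIMSEQ_unique by fastforce
qed

end

theorem theorem2p2:
  fixes q :: complex
  assumes "0 < norm q" and "norm q < 1"
  shows
    "(\<lambda>n::nat. q ^ n * qpoch q (q^2) n / (qpoch (- q) (q^2) n * (1 + q ^ (2 * n))))
        summable_on {1..} \<and>
     (\<lambda>n::nat. \<Sum>m\<in>{- int n..int n}. (-1) powi m * q powi ((int n)^2 + m^2))
        summable_on {1..} \<and>
     (\<lambda>n::nat. (-1) ^ n * q ^ (2 * n^2)) summable_on {1..} \<and>
     (\<Sum>\<^sub>\<infinity>n::nat\<in>{1..}. q ^ n * qpoch q (q^2) n / (qpoch (- q) (q^2) n * (1 + q ^ (2 * n)))) =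
       (\<Sum>\<^sub>\<infinity>n::nat\<in>{1..}. \<Sum>m\<in>{- int n..int n}. (-1) powi m * q powi ((int n)^2 + m^2)) -
       (\<Sum>\<^sub>\<infinity>n::nat\<in>{1..}. (-1) ^ n * q ^ (2 * n^2)) \<and>
     (\<Sum>\<^sub>\<infinity>n::nat\<in>{1..}. \<Sum>m\<in>{- int n..int n}. (-1) powi m * q powi ((int n)^2 + m^2)) -
       (\<Sum>\<^sub>\<infinity>n::nat\<in>{1..}. (-1) ^ n * q ^ (2 * n^2)) =
       1 / 2 * (g_sum 1 0 1 (q^2) (q^2) (q^4) + q * g_sum 1 0 1 (q^4) (q^4) (q^4) +
                theta_j (q^2) (q^4)) - 1 -
       (\<Sum>\<^sub>\<infinity>n::nat\<in>{1..}. (-1) ^ n * q ^ (2 * n^2)) \<and>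
     1 / 2 * (g_sum 1 0 1 (q^2) (q^2) (q^4) + q * g_sum 1 0 1 (q^4) (q^4) (q^4) +
              theta_j (q^2) (q^4)) - 1 -
       (\<Sum>\<^sub>\<infinity>n::nat\<in>{1..}. (-1) ^ n * q ^ (2 * n^2)) =
       1 / 2 * (g_sum 1 0 1 (q^2) (q^2) (q^4) + q * g_sum 1 0 1 (q^4) (q^4) (q^4) - 1)"
proof -
  have q0: "q \<noteq> 0" using assms(1) by auto
  note q1 = assms(2)
  note alt_square_eq = alt_square_def[of q, abs_def, symmetric]
  note summand_eq = summand_def[of q, abs_def, symmetric]
  note rows = hecke_rows_has_sum[OF q0 q1]
  show ?thesis
    unfolding alt_square_eq summand_eq
  proof (intro conjI)
    show "summand q summable_on {1..}" by (rule summand_summable[OF q0 q1])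
    show "(\<lambda>n::nat. \<Sum>m\<in>{- int n..int n}. (-1) powi m * q powi ((int n)^2 + m^2)) summable_on {1..}"
      using rows by (rule has_sum_imp_summable)
    show "alt_square q summable_on {1..}"
      by (rule alt_square_summable[OF q0 q1])
  \<comment> \<open>With A the sum of \<open>alt_square\<close> over k \<ge> 1 and B the full sum of
    \<open>alt_oblong\<close>, the double sum is (1+A)^2 + q B^2 - 1, the g-sums are (1+A)^2 + A^2
    and 2 B^2, and the theta value is 2A + 1. Polynomial identities in A, B and q remain.\<close>
  qed (unfold infsumI[OF rows] summand_infsum[OF q0 q1] g_sum_alt_square[OF q0 q1] g_sum_alt_oblong[OF q0 q1]
      theta_j_eq_infsum[OF q0 q1] infsum_alt_square[OF q0 q1], simp_all add: field_simps power2_eq_square)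
qed

end
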